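(* Let $X$ be a Banach space with an unconditional Schauder frame and let $X_0$ be a subspace of $X$ which is complemented in $X$. Then $X_0$ has an unconditional Schauder frame.
   Context: Banach spaces are over $\mathbb{K}\in\{\mathbb{R},\mathbb{C}\}$; $X^*$ denotes the topological dual of $X$. An unconditional Schauder frame of $X$ is a sequence $\{(x_n,f_n)\}_{n\ge 1}\subset X\times X^*$ such that for every $x\in X$ the series $\sum_n f_n(x)x_n$ converges unconditionally in $X$ to $x$. A complemented subspace is the range of a bounded linear projection. *)

theory Defs
  imports Complex_Main
begin

(* The scalar field is the real or the complex numbers: the second disjunct says that the field is
   R[i] with i^2 = -1, and multiplicativity of the norm then forces it to be the usual modulus. *)
class real_or_complex = real_normed_field +
  assumes real_or_complex:
    "(\<forall>z. \<exists>a. z = a *\<^sub>R 1) \<or>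
     (\<exists>i. i * i = - 1 \<and> (\<forall>z. \<exists>a b. z = a *\<^sub>R 1 + b *\<^sub>R i))"

instance real :: real_or_complex
  by standard simp

instance complex :: real_or_complex
proof
  have "z = Re z *\<^sub>R 1 + Im z *\<^sub>R \<i>" for z
    by (simp add: complex_eq_iff)
  then show "(\<forall>z::complex. \<exists>a. z = a *\<^sub>R 1) \<or>
     (\<exists>i::complex. i * i = - 1 \<and> (\<forall>z. \<exists>a b. z = a *\<^sub>R 1 + b *\<^sub>R i))"
    using i_squared by blast
qed

(* A normed space over K lives on a type of class real_normed_vector, which supplies the norm and
   the underlying real vector space; the multiplication by scalars of K extends the real one.
   With carrier type of class banach this is a Banach space over K. *)
locale normed_space_over = vector_space scale
  for scale :: "'k::real_or_complex \<Rightarrow> 'a::real_normed_vector \<Rightarrow> 'a" +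
  assumes scale_of_real: "scale (of_real r) x = r *\<^sub>R x"
    and norm_scale: "norm (scale c x) = norm c * norm x"

lemma normed_space_over_scaleR:
  "normed_space_over ((*\<^sub>R) :: real \<Rightarrow> 'a::real_normed_vector \<Rightarrow> 'a)"
  by unfold_locales (simp_all add: algebra_simps)

lemma normed_space_over_complex:
  "normed_space_over ((*) :: complex \<Rightarrow> complex \<Rightarrow> complex)"
  by unfold_locales (simp_all add: algebra_simps norm_mult scaleR_conv_of_real)

(* The topological dual of a linear subspace Y. Only the values of a functional on Y matter. *)
definition dual_on :: "('k::real_or_complex \<Rightarrow> 'a::real_normed_vector \<Rightarrow> 'a) \<Rightarrow> 'a set \<Rightarrow> ('a \<Rightarrow> 'k) set"
  where "dual_on scale Y =
    {f. (\<forall>u\<in>Y. \<forall>v\<in>Y. f (u + v) = f u + f v) \<and>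
        (\<forall>c. \<forall>u\<in>Y. f (scale c u) = c * f u) \<and>
        continuous_on Y f}"

definition unconditionally_sums :: "(nat \<Rightarrow> 'a::real_normed_vector) \<Rightarrow> 'a \<Rightarrow> bool"
  where "unconditionally_sums g s \<longleftrightarrow> (\<forall>\<pi>. bij \<pi> \<longrightarrow> (\<lambda>n. g (\<pi> n)) sums s)"

definition unconditional_schauder_frame ::
    "('k::real_or_complex \<Rightarrow> 'a::real_normed_vector \<Rightarrow> 'a) \<Rightarrow> 'a set \<Rightarrow>
     (nat \<Rightarrow> 'a) \<Rightarrow> (nat \<Rightarrow> 'a \<Rightarrow> 'k) \<Rightarrow> bool"
  where "unconditional_schauder_frame scale Y x f \<longleftrightarrow>
    (\<forall>n. x n \<in> Y) \<and> (\<forall>n. f n \<in> dual_on scale Y) \<and>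
    (\<forall>y\<in>Y. unconditionally_sums (\<lambda>n. scale (f n y) (x n)) y)"

(* bounded_linear only refers to real scalars, hence the separate linearity over K. *)
definition complemented :: "('k::real_or_complex \<Rightarrow> 'a::real_normed_vector \<Rightarrow> 'a) \<Rightarrow> 'a set \<Rightarrow> bool"
  where "complemented scale Y \<longleftrightarrow>
    (\<exists>P. Vector_Spaces.linear scale scale P \<and> bounded_linear P \<and> P \<circ> P = P \<and> range P = Y)"

end

theory Submission
  imports Defs
begin

text \<open>
  Let \<open>P\<close> be a bounded linear projection onto \<open>X\<^sub>0\<close> and \<open>(x\<^sub>n, f\<^sub>n)\<close> an unconditional Schauder frame
  of \<open>X\<close>. The frame of \<open>X\<^sub>0\<close> is \<open>(P x\<^sub>n, f\<^sub>n|X\<^sub>0)\<close>: applying \<open>P\<close> to an unconditional expansion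
  \<open>y = \<Sum> f\<^sub>n(y) x\<^sub>n\<close> keeps it unconditionally convergent, since \<open>P\<close> is continuous and additive
  (\<open>unconditionally_sums_bounded_linear\<close>), and yields \<open>P y = \<Sum> f\<^sub>n(y) P x\<^sub>n\<close>, where \<open>P y = y\<close>
  for \<open>y \<in> X\<^sub>0\<close>.
\<close>

lemma unconditionally_sums_bounded_linear:
  assumes "bounded_linear T" and "unconditionally_sums g s"
  shows "unconditionally_sums (\<lambda>n. T (g n)) (T s)"
  using assms by (auto simp: unconditionally_sums_def intro: bounded_linear.sums)

lemma dual_on_mono:
  assumes "f \<in> dual_on scale Z" and "Y \<subseteq> Z"
  shows "f \<in> dual_on scale Y"
  using assms unfolding dual_on_def by (blast intro: continuous_on_subset)

theorem proposition10:
  fixes scale :: "'k::real_or_complex \<Rightarrow> 'a::banach \<Rightarrow> 'a"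
    and X\<^sub>0 :: "'a set"
  assumes "normed_space_over scale"
    and "\<exists>x f. unconditional_schauder_frame scale UNIV x f"
    and "module.subspace scale X\<^sub>0"
    and "complemented scale X\<^sub>0"
  shows "\<exists>x f. unconditional_schauder_frame scale X\<^sub>0 x f"
proof -
  obtain x f where frame: "unconditional_schauder_frame scale UNIV x f"
    using assms(2) by blast
  obtain P where lin: "Vector_Spaces.linear scale scale P" and bdd: "bounded_linear P"
    and idem: "P \<circ> P = P" and range: "range P = X\<^sub>0"
    using assms(4) by (auto simp: complemented_def)
  have "unconditionally_sums (\<lambda>n. scale (f n y) (P (x n))) y" if "y \<in> X\<^sub>0" for y
  proof -
    have "P y = y"
      using that idem range by (metis comp_apply imageE)
    moreover have "unconditionally_sums (\<lambda>n. P (scale (f n y) (x n))) (P y)"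
      using frame by (intro unconditionally_sums_bounded_linear[OF bdd])
        (simp add: unconditional_schauder_frame_def)
    moreover have "P (scale c v) = scale c (P v)" for c v
      using lin by (simp add: Vector_Spaces.linear_iff)
    ultimately show ?thesis
      by simp
  qed
  moreover have "f n \<in> dual_on scale X\<^sub>0" for n
    using frame by (auto simp: unconditional_schauder_frame_def intro: dual_on_mono)
  ultimately have "unconditional_schauder_frame scale X\<^sub>0 (\<lambda>n. P (x n)) f"
    using range by (auto simp: unconditional_schauder_frame_def)
  then show ?thesis
    by blast
qed

end
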